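(* Let $X\in\mathbb{R}^{n\times k}$ with $X^{T}X=I_k$. Then $X$ is a KKT point of the problem $\max_{X^{T}X=I_k} f_\theta(X)$, i.e., there exists a symmetric matrix $\widehat\Lambda\in\mathbb{R}^{k\times k}$ such that $$\frac{2}{[\mathrm{trace}(X^{T}BX)]^{\theta}}\Big[AX+\frac{D}{2}-\theta f_1(X)BX\Big]=X\widehat\Lambda,$$ if and only if $X$ is an orthonormal basis matrix of a $k$-dimensional invariant subspace of $E(X)$ (equivalently, $E(X)X=X\Lambda$ for some $\Lambda\in\mathbb{R}^{k\times k}$) and $X^{T}D$ is symmetric.
   Context: Standing setting: $1\le k<n$; $A,B\in\mathbb{R}^{n\times n}$ are symmetric, $B$ is positive semidefinite with $\mathrm{rank}(B)>n-k$; $D\in\mathbb{R}^{n\times k}$; $0\le\theta\le 1$. For $X\in\mathbb{R}^{n\times k}$ with $X^{T}X=I_k$ (so that $\mathrm{trace}(X^{T}BX)>0$), define $$f_\theta(X)=\frac{\mathrm{trace}(X^{T}AX+X^{T}D)}{[\mathrm{trace}(X^{T}BX)]^{\theta}},\qquad f_1(X)=\frac{\mathrm{trace}(X^{T}AX+X^{T}D)}{\mathrm{trace}(X^{T}BX)},$$ $$E(X)=\frac{2}{[\mathrm{trace}(X^{T}BX)]^{\theta}}\Big[A+\frac{DX^{T}+XD^{T}}{2}-\theta f_1(X)B\Big].$$ *)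

theory Defs
  imports "HOL-Analysis.Analysis"
begin

text \<open>
  An n-by-k real matrix is an element of \<open>real^'k^'n\<close>, with \<open>n = CARD('n)\<close> and
  \<open>k = CARD('k)\<close>; in particular \<open>1 \<le> k\<close> holds automatically.
\<close>

definition symmetric_matrix :: "real^'m^'m \<Rightarrow> bool" where
  "symmetric_matrix M \<longleftrightarrow> transpose M = M"

definition positive_semidefinite :: "real^'m^'m \<Rightarrow> bool" where
  "positive_semidefinite M \<longleftrightarrow> symmetric_matrix M \<and> (\<forall>x. 0 \<le> x \<bullet> (M *v x))"

definition orthonormal_columns :: "real^'k^'n \<Rightarrow> bool" where
  "orthonormal_columns X \<longleftrightarrow> transpose X ** X = mat 1"

text \<open>
  For exponent 0 the denominator is 1 because the trace is positive at the points of
  interest (\<open>0 powr 0 = 0\<close> in the library).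
\<close>

definition f_theta ::
  "real \<Rightarrow> real^'n^'n \<Rightarrow> real^'n^'n \<Rightarrow> real^'k^'n \<Rightarrow> real^'k^'n \<Rightarrow> real" where
  "f_theta \<theta> A B D X =
     trace (transpose X ** A ** X + transpose X ** D) / trace (transpose X ** B ** X) powr \<theta>"

definition f_one ::
  "real^'n^'n \<Rightarrow> real^'n^'n \<Rightarrow> real^'k^'n \<Rightarrow> real^'k^'n \<Rightarrow> real" where
  "f_one A B D X =
     trace (transpose X ** A ** X + transpose X ** D) / trace (transpose X ** B ** X)"

definition E_mat ::
  "real \<Rightarrow> real^'n^'n \<Rightarrow> real^'n^'n \<Rightarrow> real^'k^'n \<Rightarrow> real^'k^'n \<Rightarrow> real^'n^'n" where
  "E_mat \<theta> A B D X =
     (2 / trace (transpose X ** B ** X) powr \<theta>) *\<^sub>R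
       (A + (1 / 2) *\<^sub>R (D ** transpose X + X ** transpose D) - (\<theta> * f_one A B D X) *\<^sub>R B)"

text \<open>
  The Lagrangian of maximizing \<open>f\<close> subject to \<open>transpose X ** X = mat 1\<close>. The
  constraint takes symmetric values, so the multiplier \<open>\<Lambda>\<close> is a symmetric k-by-k matrix;
  with the factor 1/2, stationarity reads \<open>grad f X = X ** \<Lambda>\<close>.
\<close>

definition stiefel_lagrangian ::
  "(real^'k^'n \<Rightarrow> real) \<Rightarrow> real^'k^'k \<Rightarrow> real^'k^'n \<Rightarrow> real" where
  "stiefel_lagrangian f \<Lambda> X = f X - (1 / 2) * trace (transpose \<Lambda> ** (transpose X ** X - mat 1))"

definition KKT_point :: "(real^'k^'n \<Rightarrow> real) \<Rightarrow> real^'k^'n \<Rightarrow> bool" where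
  "KKT_point f X \<longleftrightarrow> orthonormal_columns X \<and>
     (\<exists>\<Lambda>. symmetric_matrix \<Lambda> \<and> (stiefel_lagrangian f \<Lambda> has_derivative (\<lambda>H. 0)) (at X))"

definition invariant_subspace :: "real^'n^'n \<Rightarrow> (real^'n) set \<Rightarrow> bool" where
  "invariant_subspace M S \<longleftrightarrow> subspace S \<and> (\<forall>v\<in>S. M *v v \<in> S)"

definition orthonormal_basis_matrix :: "real^'k^'n \<Rightarrow> (real^'n) set \<Rightarrow> bool" where
  "orthonormal_basis_matrix X S \<longleftrightarrow> orthonormal_columns X \<and> span (columns X) = S"

end

theory Submission
  imports Defs
begin

text \<open>
  All of \<open>f\<^sub>\<theta>\<close> is built from the Frobenius inner product \<open>trace (transpose P ** Q) = P \<bullet> Q\<close>, which is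
  the inner product of the Euclidean space \<open>real^'k^'n\<close>. So the gradient of the objective can be
  read off by the product rule,
  \<open>G = c (A X + D/2 - \<theta> f\<^sub>1 B X)\<close> with \<open>c = 2 / trace (X\<^sup>T B X) powr \<theta>\<close>, while the constraint term
  of the Lagrangian has gradient \<open>X \<Lambda>\<close> when \<open>\<Lambda>\<close> is symmetric. Hence \<open>X\<close> is a KKT point
  iff \<open>G = X \<Lambda>\<close> for a symmetric \<open>\<Lambda>\<close>.

  The computation needs \<open>trace (X\<^sup>T B X) > 0\<close>, both for differentiability and for \<open>c \<noteq> 0\<close>. If this
  trace vanished, semidefiniteness would give \<open>B X = 0\<close>, and then the range of \<open>B\<close> would be
  orthogonal to the \<open>k\<close>-dimensional range of \<open>X\<close>, contradicting the rank assumption.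

  The two eigenproblems are compared through the identity
  \<open>E(X) X = G + (c/2) X (D\<^sup>T X)\<close>, a consequence of \<open>X\<^sup>T X = I\<close>: the difference
  \<open>E(X) X - G\<close> factors through \<open>X\<close>, so \<open>G = X \<Lambda>\<close> is solvable iff
  \<open>E(X) X = X \<Lambda>\<close> is. What remains is the symmetry of the multiplier. It is necessarily
  \<open>X\<^sup>T G = c (X\<^sup>T A X + X\<^sup>T D / 2 - \<theta> f\<^sub>1 X\<^sup>T B X)\<close>, and all terms except \<open>X\<^sup>T D\<close> are
  symmetric, so it is symmetric exactly when \<open>X\<^sup>T D\<close> is.
\<close>

section \<open>Linearity of matrix products and the Frobenius inner product\<close>

lemma bounded_bilinear_matrix_matrix_mult:
  "bounded_bilinear ((**) :: real^'m^'n \<Rightarrow> real^'p^'m \<Rightarrow> real^'p^'n)"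
  unfolding bilinear_conv_bounded_bilinear[symmetric] bilinear_def
  by (auto intro!: linearI
      simp: matrix_matrix_mult_def vec_eq_iff sum.distrib sum_distrib_left algebra_simps)

interpretation matrix_mult: bounded_bilinear "(**) :: real^'m^'n \<Rightarrow> real^'p^'m \<Rightarrow> real^'p^'n"
  by (rule bounded_bilinear_matrix_matrix_mult)

lemma linear_transpose: "linear (transpose :: real^'m^'n \<Rightarrow> real^'n^'m)"
  by (auto intro!: linearI simp: transpose_def vec_eq_iff)

lemmas transpose_add = linear_add[OF linear_transpose]
lemmas transpose_diff = linear_diff[OF linear_transpose]

lemma trace_transpose_mult:
  fixes P Q :: "real^'k^'n"
  shows "trace (transpose P ** Q) = P \<bullet> Q"
  by (simp add: trace_def matrix_matrix_mult_def transpose_def inner_vec_def)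
     (rule sum.swap)

lemma inner_matrix_mult_left:
  fixes P :: "real^'k^'n" and M :: "real^'m^'n" and Q :: "real^'k^'m"
  shows "P \<bullet> (M ** Q) = (transpose M ** P) \<bullet> Q"
  by (simp add: trace_transpose_mult[symmetric] matrix_transpose_mul matrix_mul_assoc)

lemma inner_matrix_mult_right:
  fixes P :: "real^'k^'n" and Q :: "real^'m^'n" and L :: "real^'k^'m"
  shows "P \<bullet> (Q ** L) = (P ** transpose L) \<bullet> Q"
  unfolding trace_transpose_mult[symmetric] matrix_transpose_mul transpose_transpose
  by (metis trace_mul_sym matrix_mul_assoc)

lemma column_matrix_mult:
  fixes M :: "real^'m^'n" and Q :: "real^'k^'m"
  shows "column j (M ** Q) = M *v column j Q"
  by (simp add: column_def matrix_matrix_mult_def matrix_vector_mult_def vec_eq_iff)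

lemma inner_eq_sum_columns:
  fixes P Q :: "real^'k^'n"
  shows "P \<bullet> Q = (\<Sum>j\<in>UNIV. column j P \<bullet> column j Q)"
  by (simp add: inner_vec_def column_def) (rule sum.swap)

section \<open>Positivity of the denominator\<close>

text \<open>
  Otherwise moving from \<open>x\<close> a little in the direction \<open>- L x\<close>, half the negative gradient of
  \<open>x \<bullet> L x\<close>, would make the form negative. Stated for operators so that it
  applies to left multiplication by a semidefinite matrix on the space of rectangular matrices.
\<close>

lemma psd_operator_eq_0:
  fixes L :: "'a::real_inner \<Rightarrow> 'a"
  assumes L: "linear L" and self_adjoint: "\<And>x y. x \<bullet> L y = L x \<bullet> y"
    and psd: "\<And>x. 0 \<le> x \<bullet> L x" and zero: "x \<bullet> L x = 0"
  shows "L x = 0"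
proof (rule ccontr)
  define p q where "p = L x \<bullet> L x" and "q = L x \<bullet> L (L x)"
  assume "L x \<noteq> 0"
  then have p: "p > 0" by (simp add: p_def)
  have q: "q \<ge> 0" using psd by (simp add: q_def)
  have quad: "0 \<le> - 2 * t * p + t * t * q" for t
  proof -
    have "(x - t *\<^sub>R L x) \<bullet> L (x - t *\<^sub>R L x) = - 2 * t * p + t * t * q"
      using zero self_adjoint[of x "L x"]
      by (simp add: linear_diff[OF L] linear_scale[OF L] inner_diff_left inner_diff_right
          p_def q_def algebra_simps)
    then show ?thesis using psd by metis
  qed
  \<comment> \<open>For \<open>q > 0\<close> the minimizer over \<open>t\<close> is \<open>p / q\<close>; the shifted denominator also covers \<open>q = 0\<close>.\<close>
  define t where "t = p / (q + 1)"
  have t: "t > 0" "t * q < p" using p q by (simp_all add: t_def field_simps)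
  have "t * (2 * p) \<le> t * (t * q)" using quad[of t] by (simp add: algebra_simps)
  then have "2 * p \<le> t * q" using t(1) by (simp only: mult_le_cancel_left_pos)
  then show False using t(2) p by linarith
qed

lemma orthonormal_columns_inj:
  fixes X :: "real^'k^'n"
  assumes "orthonormal_columns X"
  shows "inj ((*v) X)"
  using assms matrix_left_invertible_injective orthonormal_columns_def by blast

text \<open>The ranges of \<open>X\<close> and \<open>M\<close> are orthogonal, so their dimensions add up.\<close>

lemma rank_add_rank_le:
  fixes X :: "real^'k^'n" and M :: "real^'m^'n"
  assumes "transpose X ** M = 0"
  shows "rank X + rank M \<le> CARD('n)"
proof -
  have "(X *v u) \<bullet> (M *v w) = 0" for u w
  proof -
    have "(X *v u) \<bullet> (M *v w) = u \<bullet> ((transpose X ** M) *v w)"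
      by (metis dot_lmul_matrix matrix_vector_mul_assoc vector_transpose_matrix)
    then show ?thesis using assms by simp
  qed
  then have "dim (range ((*v) X) \<union> range ((*v) M)) = rank X + rank M"
    by (subst dim_orthogonal_sum) (auto simp: rank_dim_range)
  then show ?thesis
    by (metis dim_subset_UNIV DIM_cart DIM_real mult.right_neutral)
qed

lemma trace_quadratic_pos:
  fixes B :: "real^'n^'n" and X :: "real^'k^'n"
  assumes B: "positive_semidefinite B" and rank: "rank B > CARD('n) - CARD('k)"
    and X: "orthonormal_columns X"
  shows "trace (transpose X ** B ** X) > 0"
proof (rule ccontr)
  have sym: "transpose B = B"
    using B by (simp add: positive_semidefinite_def symmetric_matrix_def)
  have psd: "0 \<le> Y \<bullet> (B ** Y)" for Y :: "real^'k^'n"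
    using B unfolding inner_eq_sum_columns column_matrix_mult positive_semidefinite_def
    by (simp add: sum_nonneg)
  assume "\<not> trace (transpose X ** B ** X) > 0"
  then have "X \<bullet> (B ** X) = 0"
    using psd[of X] by (simp add: trace_transpose_mult flip: matrix_mul_assoc)
  then have "B ** X = 0"
    by (intro psd_operator_eq_0[where L = "(**) B"] psd)
       (auto simp: inner_matrix_mult_left sym intro: linearI matrix_mult.add_right
         matrix_mult.scaleR_right)
  then have "transpose X ** B = 0"
    by (metis matrix_transpose_mul sym linear_0[OF linear_transpose])
  then have "rank X + rank B \<le> CARD('n)" by (rule rank_add_rank_le)
  moreover have "rank X = CARD('k)"
    using orthonormal_columns_inj[OF X] full_rank_injective by blast
  ultimately show False using rank by linarith
qed

section \<open>Stationarity on the Stiefel manifold\<close>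

text \<open>
  Used both for left multiplication by \<open>A\<close> and \<open>B\<close> and for right multiplication by a
  symmetric multiplier.
\<close>

lemma quadratic_form_has_derivative:
  fixes L :: "'a::real_inner \<Rightarrow> 'a"
  assumes L: "bounded_linear L" and self_adjoint: "\<And>x y. x \<bullet> L y = L x \<bullet> y"
  shows "((\<lambda>y. y \<bullet> L y) has_derivative (\<lambda>h. 2 * (h \<bullet> L x))) (at x)"
proof -
  have "x \<bullet> L h + h \<bullet> L x = 2 * (h \<bullet> L x)" for h
    using self_adjoint[of x h] by (simp add: inner_commute)
  with has_derivative_inner[OF has_derivative_ident bounded_linear_imp_has_derivative[OF L],
      of x UNIV]
  show ?thesis by simp
qed

text \<open>
  The constraint term of the Lagrangian is, up to a constant, \<open>X \<bullet> (X ** \<Lambda>) / 2\<close>, a quadratic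
  form whose gradient is \<open>X ** \<Lambda>\<close> because \<open>\<Lambda>\<close> is symmetric.
\<close>

lemma stiefel_lagrangian_has_derivative:
  fixes f :: "real^'k^'n \<Rightarrow> real"
  assumes f: "(f has_derivative (\<lambda>H. H \<bullet> G)) (at X)" and sym: "symmetric_matrix \<Lambda>"
  shows "(stiefel_lagrangian f \<Lambda> has_derivative (\<lambda>H. H \<bullet> (G - X ** \<Lambda>))) (at X)"
proof -
  have \<Lambda>: "transpose \<Lambda> = \<Lambda>" using sym by (simp add: symmetric_matrix_def)
  have "trace (transpose \<Lambda> ** (transpose Y ** Y - mat 1)) = Y \<bullet> (Y ** \<Lambda>) - trace \<Lambda>"
    for Y :: "real^'k^'n"
  proof -
    have "trace (\<Lambda> ** (transpose Y ** Y)) = Y \<bullet> (Y ** \<Lambda>)"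
      by (metis trace_transpose_mult trace_mul_sym matrix_mul_assoc)
    then show ?thesis by (simp add: \<Lambda> matrix_mult.diff_right trace_sub)
  qed
  then have eq: "stiefel_lagrangian f \<Lambda> = (\<lambda>Y. f Y - 1/2 * (Y \<bullet> (Y ** \<Lambda>) - trace \<Lambda>))"
    by (simp add: fun_eq_iff stiefel_lagrangian_def)
  have quad: "((\<lambda>Y. Y \<bullet> (Y ** \<Lambda>)) has_derivative (\<lambda>H. 2 * (H \<bullet> (X ** \<Lambda>)))) (at X)"
    by (rule quadratic_form_has_derivative[OF matrix_mult.bounded_linear_left])
       (simp add: inner_matrix_mult_right \<Lambda>)
  show ?thesis unfolding eq
    by (rule derivative_eq_intros f quad refl)+ (simp add: fun_eq_iff inner_diff_right)
qed

lemma KKT_point_iff_gradient: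
  fixes f :: "real^'k^'n \<Rightarrow> real"
  assumes f: "(f has_derivative (\<lambda>H. H \<bullet> G)) (at X)" and X: "orthonormal_columns X"
  shows "KKT_point f X \<longleftrightarrow> (\<exists>\<Lambda>. symmetric_matrix \<Lambda> \<and> G = X ** \<Lambda>)"
proof -
  have "(stiefel_lagrangian f \<Lambda> has_derivative (\<lambda>H. 0)) (at X) \<longleftrightarrow> G = X ** \<Lambda>"
    if "symmetric_matrix \<Lambda>" for \<Lambda>
  proof
    note der = stiefel_lagrangian_has_derivative[OF f that]
    show "G = X ** \<Lambda>" if "(stiefel_lagrangian f \<Lambda> has_derivative (\<lambda>H. 0)) (at X)"
    proof -
      have "(\<lambda>H. H \<bullet> (G - X ** \<Lambda>)) = (\<lambda>H. 0)" using has_derivative_unique[OF der that] .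
      then have "(G - X ** \<Lambda>) \<bullet> (G - X ** \<Lambda>) = 0" by metis
      then show ?thesis by simp
    qed
    show "(stiefel_lagrangian f \<Lambda> has_derivative (\<lambda>H. 0)) (at X)" if "G = X ** \<Lambda>"
      using der that by simp
  qed
  then show ?thesis using X unfolding KKT_point_def by blast
qed

lemma f_theta_has_derivative:
  fixes A B :: "real^'n^'n" and D X :: "real^'k^'n"
  assumes A: "symmetric_matrix A" and B: "symmetric_matrix B"
    and pos: "trace (transpose X ** B ** X) > 0"
  shows "(f_theta \<theta> A B D has_derivative
     (\<lambda>H. H \<bullet> ((2 / trace (transpose X ** B ** X) powr \<theta>) *\<^sub>R
        (A ** X + (1 / 2) *\<^sub>R D - (\<theta> * f_one A B D X) *\<^sub>R (B ** X))))) (at X)"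
proof -
  define N where "N = (\<lambda>Y :: real^'k^'n. Y \<bullet> (A ** Y) + Y \<bullet> D)"
  define T where "T = (\<lambda>Y :: real^'k^'n. Y \<bullet> (B ** Y))"
  have T: "trace (transpose Y ** B ** Y) = T Y" for Y
    by (simp add: T_def trace_transpose_mult flip: matrix_mul_assoc)
  have N: "trace (transpose Y ** A ** Y + transpose Y ** D) = N Y" for Y
    by (simp add: N_def trace_transpose_mult trace_add flip: matrix_mul_assoc)
  have f1: "f_one A B D X = N X / T X"
    by (simp only: f_one_def T N)
  have f: "f_theta \<theta> A B D = (\<lambda>Y. N Y * T Y powr (- \<theta>))"
    by (simp add: fun_eq_iff f_theta_def T N powr_minus divide_inverse)
  have quad: "((\<lambda>Y. Y \<bullet> (M ** Y)) has_derivative (\<lambda>H. 2 * (H \<bullet> (M ** X)))) (at X)"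
    if "symmetric_matrix M" for M :: "real^'n^'n"
    by (rule quadratic_form_has_derivative[OF matrix_mult.bounded_linear_right])
       (use that in \<open>simp add: inner_matrix_mult_left symmetric_matrix_def\<close>)
  have TX: "T X > 0" using pos by (simp add: T)
  have dN: "(N has_derivative (\<lambda>H. 2 * (H \<bullet> (A ** X)) + H \<bullet> D)) (at X)"
    unfolding N_def by (rule derivative_eq_intros quad[OF A] refl)+ simp
  have dT: "(T has_derivative (\<lambda>H. 2 * (H \<bullet> (B ** X)))) (at X)"
    unfolding T_def by (rule quad[OF B])
  have dP: "((\<lambda>Y. T Y powr (- \<theta>)) has_derivative
      (\<lambda>H. T X powr (- \<theta>) * (- \<theta> * (2 * (H \<bullet> (B ** X))) / T X))) (at X)"
    by (rule derivative_eq_intros dT TX refl)+ (use TX in \<open>auto simp: fun_eq_iff\<close>)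
  have "(f_theta \<theta> A B D has_derivative
      (\<lambda>H. N X * (T X powr (- \<theta>) * (- \<theta> * (2 * (H \<bullet> (B ** X))) / T X))
         + (2 * (H \<bullet> (A ** X)) + H \<bullet> D) * T X powr (- \<theta>))) (at X)"
    unfolding f by (rule has_derivative_mult[OF dN dP])
  then show ?thesis
    by (rule has_derivative_eq_rhs)
       (use TX in \<open>simp add: fun_eq_iff T f1 powr_minus inner_add_right inner_diff_right
          field_simps\<close>)
qed

section \<open>Invariant subspaces\<close>

lemma invariant_subspace_iff_matrix_eq:
  fixes M :: "real^'n^'n" and X :: "real^'k^'n"
  assumes X: "orthonormal_columns X"
  shows "(\<exists>S. invariant_subspace M S \<and> dim S = CARD('k) \<and> orthonormal_basis_matrix X S) \<longleftrightarrow>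
    (\<exists>\<Lambda> :: real^'k^'k. M ** X = X ** \<Lambda>)"
proof -
  have XX: "transpose X ** X = mat 1" using X by (simp add: orthonormal_columns_def)
  have range: "range ((*v) X) = span (columns X)"
  proof
    show "range ((*v) X) \<subseteq> span (columns X)"
      using matrix_vector_mult_in_columnspace by blast
    show "span (columns X) \<subseteq> range ((*v) X)"
      by (intro span_minimal linear_subspace_image)
         (auto simp: columns_image_basis subspace_UNIV)
  qed
  then have dim: "dim (span (columns X)) = CARD('k)"
    using orthonormal_columns_inj[OF X] full_rank_injective[of X] by (simp add: rank_dim_range)
  have "(\<forall>v\<in>span (columns X). M *v v \<in> span (columns X)) \<longleftrightarrow>
      (\<exists>\<Lambda> :: real^'k^'k. M ** X = X ** \<Lambda>)"
  proof
    assume inv: "\<forall>v\<in>span (columns X). M *v v \<in> span (columns X)"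
    \<comment> \<open>\<open>X ** transpose X\<close> is the projection onto the column space, which fixes the columns of \<open>M ** X\<close>.\<close>
    have "(M ** X) *v w = (X ** (transpose X ** M ** X)) *v w" for w
    proof -
      obtain u where u: "M *v (X *v w) = X *v u"
        using inv unfolding range[symmetric] by blast
      have "X *v (transpose X *v (X *v u)) = X *v u"
        by (simp only: matrix_vector_mul_assoc XX) (simp add: matrix_vector_mul_assoc)
      with u show ?thesis by (metis matrix_vector_mul_assoc)
    qed
    then show "\<exists>\<Lambda> :: real^'k^'k. M ** X = X ** \<Lambda>" by (metis matrix_eq)
  next
    assume "\<exists>\<Lambda> :: real^'k^'k. M ** X = X ** \<Lambda>"
    then obtain \<Lambda> :: "real^'k^'k" where "M ** X = X ** \<Lambda>" ..
    then have "M *v (X *v w) = X *v (\<Lambda> *v w)" for w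
      by (simp add: matrix_vector_mul_assoc)
    then show "\<forall>v\<in>span (columns X). M *v v \<in> span (columns X)"
      by (auto simp flip: range)
  qed
  then show ?thesis
    using X dim by (auto simp: invariant_subspace_def orthonormal_basis_matrix_def)
qed

section \<open>Comparing the two eigenproblems\<close>

text \<open>
  Since \<open>transpose X ** X = mat 1\<close>, the symmetrized term \<open>D X\<^sup>T + X D\<^sup>T\<close> of \<open>E\<close> sends
  \<open>X\<close> to \<open>D\<close> plus a matrix that factors through \<open>X\<close>.
\<close>

lemma E_mat_mult:
  fixes A B :: "real^'n^'n" and D X :: "real^'k^'n" and \<theta> :: real
  assumes X: "orthonormal_columns X"
  defines "c \<equiv> 2 / trace (transpose X ** B ** X) powr \<theta>"
  shows "E_mat \<theta> A B D X ** X =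
    c *\<^sub>R (A ** X + (1 / 2) *\<^sub>R D - (\<theta> * f_one A B D X) *\<^sub>R (B ** X))
      + X ** ((c / 2) *\<^sub>R (transpose D ** X))"
proof -
  have "(D ** transpose X) ** X = D" "(X ** transpose D) ** X = X ** (transpose D ** X)"
    using X by (simp_all add: orthonormal_columns_def flip: matrix_mul_assoc)
  then show ?thesis
    by (simp add: E_mat_def c_def matrix_mult.add_left matrix_mult.diff_left
        matrix_mult.scaleR_left matrix_mult.scaleR_right scaleR_add_right scaleR_diff_right)
qed

lemma orthonormal_columns_cancel:
  fixes X :: "real^'k^'n" and \<Lambda> :: "real^'m^'k"
  assumes "orthonormal_columns X"
  shows "transpose X ** (X ** \<Lambda>) = \<Lambda>"
  using assms by (simp add: orthonormal_columns_def matrix_mul_assoc)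

text \<open>
  The multiplier is \<open>transpose X ** G\<close>, whose antisymmetric part is a multiple of that of
  \<open>transpose X ** D\<close>.
\<close>

lemma multiplier_symmetric_iff:
  fixes A B :: "real^'n^'n" and D X :: "real^'k^'n" and \<Lambda> :: "real^'k^'k"
  assumes A: "symmetric_matrix A" and B: "symmetric_matrix B"
    and X: "orthonormal_columns X" and c: "c \<noteq> 0"
    and eq: "c *\<^sub>R (A ** X + (1 / 2) *\<^sub>R D - r *\<^sub>R (B ** X)) = X ** \<Lambda>"
  shows "symmetric_matrix \<Lambda> \<longleftrightarrow> symmetric_matrix (transpose X ** D)"
proof -
  have congr: "transpose (transpose X ** M ** X) = transpose X ** M ** X"
    if "symmetric_matrix M" for M :: "real^'n^'n"
    using that by (simp add: symmetric_matrix_def matrix_transpose_mul matrix_mul_assoc)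
  have \<Lambda>: "\<Lambda> = c *\<^sub>R (transpose X ** A ** X + (1 / 2) *\<^sub>R (transpose X ** D)
      - r *\<^sub>R (transpose X ** B ** X))"
    unfolding orthonormal_columns_cancel[OF X, of \<Lambda>, folded eq, symmetric]
    by (simp add: matrix_mult.add_right matrix_mult.diff_right matrix_mult.scaleR_right
        matrix_mul_assoc)
  show ?thesis
    unfolding \<Lambda> symmetric_matrix_def
    using c by (simp add: transpose_scalar transpose_add transpose_diff congr[OF A] congr[OF B])
qed

theorem theorem2p1:
  fixes A B :: "real^'n^'n" and D X :: "real^'k^'n" and \<theta> :: real
  assumes "CARD('k) < CARD('n)"
    and "symmetric_matrix A"
    and "symmetric_matrix B"
    and "positive_semidefinite B"
    and "rank B > CARD('n) - CARD('k)"
    and "0 \<le> \<theta>" and "\<theta> \<le> 1"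
    and "orthonormal_columns X"
  shows
    "(KKT_point (f_theta \<theta> A B D) X \<longleftrightarrow>
        (\<exists>S. invariant_subspace (E_mat \<theta> A B D X) S \<and> dim S = CARD('k) \<and>
             orthonormal_basis_matrix X S) \<and>
        symmetric_matrix (transpose X ** D)) \<and>
     (KKT_point (f_theta \<theta> A B D) X \<longleftrightarrow>
        (\<exists>\<Lambda> :: real^'k^'k. symmetric_matrix \<Lambda> \<and>
             (2 / trace (transpose X ** B ** X) powr \<theta>) *\<^sub>R
               (A ** X + (1 / 2) *\<^sub>R D - (\<theta> * f_one A B D X) *\<^sub>R (B ** X)) = X ** \<Lambda>)) \<and>
     ((\<exists>S. invariant_subspace (E_mat \<theta> A B D X) S \<and> dim S = CARD('k) \<and>
           orthonormal_basis_matrix X S) \<longleftrightarrow>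
        (\<exists>\<Lambda> :: real^'k^'k. E_mat \<theta> A B D X ** X = X ** \<Lambda>))"
proof -
  define c where "c = 2 / trace (transpose X ** B ** X) powr \<theta>"
  define G where
    "G = c *\<^sub>R (A ** X + (1 / 2) *\<^sub>R D - (\<theta> * f_one A B D X) *\<^sub>R (B ** X))"
  note A = assms(2) and B = assms(3) and X = assms(8)
  have pos: "trace (transpose X ** B ** X) > 0"
    using trace_quadratic_pos assms by blast
  then have c: "c \<noteq> 0" by (simp add: c_def)
  have KKT: "KKT_point (f_theta \<theta> A B D) X \<longleftrightarrow> (\<exists>\<Lambda>. symmetric_matrix \<Lambda> \<and> G = X ** \<Lambda>)"
    unfolding G_def c_def
    by (rule KKT_point_iff_gradient[OF f_theta_has_derivative[OF A B pos] X])
  have sym: "symmetric_matrix \<Lambda> \<longleftrightarrow> symmetric_matrix (transpose X ** D)" if "G = X ** \<Lambda>" for \<Lambda>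
    using multiplier_symmetric_iff[OF A B X c] that unfolding G_def by blast
  have E: "E_mat \<theta> A B D X ** X = G + X ** ((c / 2) *\<^sub>R (transpose D ** X))"
    using E_mat_mult[OF X] by (simp add: G_def c_def)
  have "E_mat \<theta> A B D X ** X = X ** (\<Lambda> + (c / 2) *\<^sub>R (transpose D ** X)) \<longleftrightarrow> G = X ** \<Lambda>" for \<Lambda>
    unfolding E by (simp add: matrix_mult.add_right)
  then have solvable: "(\<exists>\<Lambda> :: real^'k^'k. E_mat \<theta> A B D X ** X = X ** \<Lambda>) \<longleftrightarrow>
      (\<exists>\<Lambda> :: real^'k^'k. G = X ** \<Lambda>)"
    by (metis diff_add_cancel)
  show ?thesis
    unfolding invariant_subspace_iff_matrix_eq[OF X] KKT solvable c_def[symmetric] G_def[symmetric]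
    using sym by blast
qed

end
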